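(* For every $\varepsilon>0$ there exists an open bounded convex domain $\Omega\subset\mathbb{H}$ such that $$\int_\Omega\frac{|u(x)|^2}{\delta_C(x)^2}\,dx\;\le\;(2+\varepsilon)^2\int_\Omega|\nabla_{\mathbb{H}}u(x)|^2\,dx\qquad\text{for all }u\in C_0^\infty(\Omega).$$
   Context: $\mathbb{H}$ is the first Heisenberg group: $\mathbb{R}^3$ with the group law $(x_1,x_2,x_3)\boxplus(y_1,y_2,y_3)=\left(x_1+y_1,\;x_2+y_2,\;x_3+y_3-\tfrac12(x_1y_2-x_2y_1)\right)$. Topological notions, convexity and $dx$ (Lebesgue measure) are those of $\mathbb{R}^3$. The sub-gradient is $\nabla_{\mathbb{H}}=(X_1,X_2)$ with $X_1=\partial_{x_1}+\frac{x_2}{2}\partial_{x_3}$, $X_2=\partial_{x_2}-\frac{x_1}{2}\partial_{x_3}$, so $|\nabla_{\mathbb{H}}u|^2=|X_1u|^2+|X_2u|^2$. A Lipschitz curve $\gamma=(\gamma_1,\gamma_2,\gamma_3):[a,b]\to\mathbb{H}$ is horizontal if $\gamma'(t)\in\mathrm{span}\{(1,0,\gamma_2(t)/2),(0,1,-\gamma_1(t)/2)\}$ (for a.e. $t$). The Carnot-Carathéodory distance is $d_C(x,y)=\inf_\gamma\int_a^b\sqrt{\gamma_1'(t)^2+\gamma_2'(t)^2}\,dt$, the infimum being over all horizontal curves connecting $x$ and $y$. For $x\in\Omega$, $\delta_C(x)=\inf_{y\in\partial\Omega}d_C(x,y)$. $C_0^\infty(\Omega)$ denotes smooth functions with compact support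 in $\Omega$. *)

theory Defs
  imports "HOL-Analysis.Analysis"
begin

text \<open>The underlying space of the first Heisenberg group. The group law enters only through the
  left-invariant vector fields below.\<close>

type_synonym heisenberg = "real^3"

definition partial_deriv :: "3 \<Rightarrow> (heisenberg \<Rightarrow> complex) \<Rightarrow> heisenberg \<Rightarrow> complex" where
  "partial_deriv i u x = frechet_derivative u (at x) (axis i 1)"

definition X1 :: "(heisenberg \<Rightarrow> complex) \<Rightarrow> heisenberg \<Rightarrow> complex" where
  "X1 u x = partial_deriv 1 u x + complex_of_real (x $ 2 / 2) * partial_deriv 3 u x"

definition X2 :: "(heisenberg \<Rightarrow> complex) \<Rightarrow> heisenberg \<Rightarrow> complex" where
  "X2 u x = partial_deriv 2 u x - complex_of_real (x $ 1 / 2) * partial_deriv 3 u x"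

definition subgrad_norm_sq :: "(heisenberg \<Rightarrow> complex) \<Rightarrow> heisenberg \<Rightarrow> real" where
  "subgrad_norm_sq u x = (cmod (X1 u x))\<^sup>2 + (cmod (X2 u x))\<^sup>2"

text \<open>Differentiability almost everywhere is automatic for Lipschitz curves; it is spelled out
  because the vector derivative has an unspecified value elsewhere.\<close>

definition horizontal_curve :: "real \<Rightarrow> real \<Rightarrow> (real \<Rightarrow> heisenberg) \<Rightarrow> bool" where
  "horizontal_curve a b \<gamma> \<longleftrightarrow>
     a < b \<and> (\<exists>L. L-lipschitz_on {a..b} \<gamma>) \<and>
     (AE t\<in>{a..b} in lebesgue.
        \<gamma> differentiable (at t within {a..b}) \<and>
        vector_derivative \<gamma> (at t within {a..b})
          \<in> span {vector [1, 0, \<gamma> t $ 2 / 2], vector [0, 1, - (\<gamma> t $ 1 / 2)]})"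

definition horizontal_length :: "real \<Rightarrow> real \<Rightarrow> (real \<Rightarrow> heisenberg) \<Rightarrow> real" where
  "horizontal_length a b \<gamma> =
     integral {a..b} (\<lambda>t. sqrt ((vector_derivative \<gamma> (at t within {a..b}) $ 1)\<^sup>2 +
                                 (vector_derivative \<gamma> (at t within {a..b}) $ 2)\<^sup>2))"

text \<open>Any two points are joined by a horizontal curve, so the infimum is over a nonempty set of
  nonnegative reals. The boundary in \<open>delta_C\<close> is nonempty for nonempty bounded open sets.\<close>

definition d_C :: "heisenberg \<Rightarrow> heisenberg \<Rightarrow> real" where
  "d_C x y = Inf {horizontal_length a b \<gamma> | a b \<gamma>.
                    horizontal_curve a b \<gamma> \<and> \<gamma> a = x \<and> \<gamma> b = y}"

definition delta_C :: "heisenberg set \<Rightarrow> heisenberg \<Rightarrow> real" where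
  "delta_C \<Omega> x = (INF y\<in>frontier \<Omega>. d_C x y)"

primrec C_k :: "nat \<Rightarrow> (heisenberg \<Rightarrow> complex) \<Rightarrow> bool" where
  "C_k 0 u \<longleftrightarrow> continuous_on UNIV u"
| "C_k (Suc k) u \<longleftrightarrow> (\<forall>x. u differentiable (at x)) \<and> (\<forall>i. C_k k (partial_deriv i u))"

text \<open>Test functions on \<open>\<Omega>\<close>, extended by zero to the whole space.\<close>

definition test_functions :: "heisenberg set \<Rightarrow> (heisenberg \<Rightarrow> complex) set" where
  "test_functions \<Omega> =
     {u. (\<forall>k. C_k k u) \<and> compact (closure {x. u x \<noteq> 0}) \<and> closure {x. u x \<noteq> 0} \<subseteq> \<Omega>}"

end

theory Submission
  imports Defs
begin

text \<open>The domain is a thin lens \<open>{x. \<bar>x\<^sub>1\<bar> < h (1 - x\<^sub>2\<^sup>2 - x\<^sub>3\<^sup>2)}\<close> with small \<open>h\<close>. All normals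
  of its boundary point almost in the direction \<open>\<plusminus>e\<^sub>1\<close>, so that the boundary is approached most
  quickly by following the single field \<open>X\<^sub>1\<close>, and the inequality reduces to the one-dimensional
  Hardy inequality with constant \<open>4 = 2\<^sup>2\<close> along the integral curves of \<open>X\<^sub>1\<close>, up to factors that
  tend to \<open>1\<close> with \<open>h\<close>. Write \<open>g\<^sub>\<plusminus> = h (1 - x\<^sub>2\<^sup>2 - x\<^sub>3\<^sup>2) \<mp> x\<^sub>1\<close>, two concave functions that are
  both positive exactly on the lens.

  Distance: a horizontal velocity satisfies \<open>2 v\<^sub>3 = v\<^sub>1 x\<^sub>2 - v\<^sub>2 x\<^sub>1\<close>, and all coordinates lie in
  \<open>[-1, 1]\<close> on the lens. Hence \<open>g\<^sub>\<plusminus>\<close> decreases along a horizontal curve inside the lens at most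
  \<open>1 + 4 h\<close> times as fast as the length grows. Stopping a curve at its first exit from the lens,
  where one of \<open>g\<^sub>\<plusminus>\<close> vanishes, gives \<open>min g\<^sub>+ g\<^sub>- \<le> (1 + 4 h) \<delta>\<^sub>C\<close> (lemma \<open>gap_le_delta_C\<close>).

  Hardy inequality: put \<open>F = (1 - h)/2 (1/g\<^sub>+ - 1/g\<^sub>-)\<close>. Since \<open>X\<^sub>1 g\<^sub>\<plusminus> = \<mp>1 - h x\<^sub>2 x\<^sub>3\<close>, one has
  \<open>X\<^sub>1 F - F\<^sup>2 \<ge> (1 - h)\<^sup>2/4 (1/g\<^sub>+\<^sup>2 + 1/g\<^sub>-\<^sup>2)\<close>, whereas completing a square gives
  \<open>X\<^sub>1 (F \<bar>u\<bar>\<^sup>2) \<ge> (X\<^sub>1 F - F\<^sup>2) \<bar>u\<bar>\<^sup>2 - \<bar>X\<^sub>1 u\<bar>\<^sup>2\<close>. The left-hand side integrates to zero, because the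
  flow of \<open>X\<^sub>1\<close> consists of volume preserving shears (lemma \<open>integral_flow_derivative_eq_0\<close>), and
  lemma \<open>hardy_lens\<close> follows. As \<open>1/g\<^sub>+\<^sup>2 + 1/g\<^sub>-\<^sup>2 \<ge> 1/(min g\<^sub>+ g\<^sub>-)\<^sup>2\<close>, the two parts combine to the
  constant \<open>(2 (1 + 4 h)/(1 - h))\<^sup>2\<close>.\<close>

section \<open>Lipschitz curves and the fundamental theorem of calculus\<close>

lemma forward_difference_quotients_tendsto:
  fixes f :: "real \<Rightarrow> 'a::real_normed_vector"
  assumes f: "(f has_vector_derivative d) (at t within S)"
    and h: "h \<longlonglongrightarrow> 0" "\<And>n. h n > 0" and S: "\<forall>\<^sub>F n in sequentially. t + h n \<in> S"
  shows "(\<lambda>n. (f (t + h n) - f t) /\<^sub>R h n) \<longlonglongrightarrow> d"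
proof -
  have "filterlim (\<lambda>n. t + h n) (at t within S) sequentially"
    unfolding filterlim_at using S h tendsto_add[OF tendsto_const[of t] h(1)]
    by (auto elim!: eventually_mono simp: less_imp_neq[THEN not_sym])
  moreover have "((\<lambda>y. (1 / norm (y - t)) *\<^sub>R (f y - (f t + (y - t) *\<^sub>R d))) \<longlongrightarrow> 0) (at t within S)"
    using f unfolding has_vector_derivative_def has_derivative_within by simp
  ultimately have "(\<lambda>n. (1 / norm (h n)) *\<^sub>R (f (t + h n) - (f t + h n *\<^sub>R d))) \<longlonglongrightarrow> 0"
    by (auto dest: filterlim_compose)
  moreover have "(1 / norm (h n)) *\<^sub>R (f (t + h n) - (f t + h n *\<^sub>R d)) = (f (t + h n) - f t) /\<^sub>R h n - d" for n
    using h(2)[of n] by (simp add: algebra_simps divide_inverse)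
  ultimately show ?thesis
    by (simp add: LIM_zero_iff)
qed

text \<open>The difference quotients of a Lipschitz function are bounded by the Lipschitz constant and
  converge off a null set, so their integrals converge by dominated convergence. On the other hand
  the integral over \<open>[a, b]\<close> of a difference quotient with step \<open>h\<close> is the mean of the function
  over \<open>[b, b + h]\<close> minus that over \<open>[a, a + h]\<close>, which tends to \<open>f b - f a\<close>.\<close>

lemma lipschitz_fundamental_theorem_of_calculus:
  fixes f f' :: "real \<Rightarrow> 'a::euclidean_space"
  assumes ab: "a < b" and L: "L-lipschitz_on {a..b} f" and N: "negligible N"
    and f': "\<And>t. t \<in> {a..b} - N \<Longrightarrow> (f has_vector_derivative f' t) (at t within {a..b})"
  shows "(f' has_integral (f b - f a)) {a..b}" and "f' absolutely_integrable_on {a..b}"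
proof -
  (* Constant extension beyond the interval, so that forward difference quotients make sense at b. *)
  define F where "F t = f (max a (min t b))" for t
  define h :: "nat \<Rightarrow> real" where "h n = 1 / real (Suc n)" for n
  have h: "h n > 0" "h n \<le> 1" for n by (auto simp: h_def)
  have h0: "h \<longlonglongrightarrow> 0" unfolding h_def by (rule LIMSEQ_Suc[OF lim_1_over_n])
  have lipF: "norm (F s - F t) \<le> L * \<bar>s - t\<bar>" for s t
  proof -
    have "norm (F s - F t) \<le> L * \<bar>max a (min s b) - max a (min t b)\<bar>"
      using lipschitz_onD[OF L, of "max a (min s b)" "max a (min t b)"] ab
      by (simp add: F_def dist_norm)
    also have "\<dots> \<le> L * \<bar>s - t\<bar>"
      using lipschitz_on_nonneg[OF L] by (intro mult_left_mono) auto
    finally show ?thesis .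
  qed
  have contF: "continuous_on S F" for S
    using lipF lipschitz_on_nonneg[OF L]
    by (intro lipschitz_on_continuous_on[of L] lipschitz_onI) (auto simp: dist_norm)
  have intF: "F integrable_on {c..d}" for c d
    by (intro integrable_continuous_interval contF)
  define q where "q n t = (F (t + h n) - F t) /\<^sub>R h n" for n t
  define Q where "Q n = integral {a..b} (q n)" for n
  (* An antiderivative whose base point lies below a, so that it is differentiable at a itself. *)
  define P where "P s = integral {a-1..s} F" for s
  have Qeq: "Q n = (P (b + h n) - P b) /\<^sub>R h n - (P (a + h n) - P a) /\<^sub>R h n" for n
  proof -
    have "integral {a..b} (\<lambda>t. F (t + h n)) = integral {a + h n..b + h n} F"
      using integral_shift_Icc_real[of a b F "h n"] by (simp add: o_def add.commute)
    moreover have "P (a + h n) + integral {a + h n..b + h n} F = P (b + h n)"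
      unfolding P_def using h[of n] ab by (intro Henstock_Kurzweil_Integration.integral_combine intF) auto
    moreover have "P a + integral {a..b} F = P b"
      unfolding P_def using ab by (intro Henstock_Kurzweil_Integration.integral_combine intF) auto
    moreover have "(\<lambda>t. F (t + h n)) integrable_on {a..b}"
      by (intro integrable_continuous_interval continuous_on_compose2[OF contF[of UNIV]] continuous_intros) auto
    moreover from this intF[of a b]
    have "Q n = (integral {a..b} (\<lambda>t. F (t + h n)) - integral {a..b} F) /\<^sub>R h n"
      unfolding Q_def q_def by (simp add: Henstock_Kurzweil_Integration.integral_diff)
    ultimately show ?thesis
      by (simp add: algebra_simps flip: scaleR_right_diff_distrib)
  qed
  have Plim: "(\<lambda>n. (P (c + h n) - P c) /\<^sub>R h n) \<longlonglongrightarrow> F c" if "c \<in> {a..b}" for c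
  proof -
    have "(P has_vector_derivative F c) (at c within {a-1..b+1})"
      unfolding P_def using that by (intro integral_has_vector_derivative contF) auto
    hence "(P has_vector_derivative F c) (at c)"
      using that by (subst (asm) at_within_Icc_at) auto
    thus ?thesis
      by (rule forward_difference_quotients_tendsto[OF _ h0 h(1)]) simp
  qed
  have Qlim: "Q \<longlonglongrightarrow> f b - f a"
    using tendsto_diff[OF Plim[of b] Plim[of a]] ab unfolding Qeq by (simp add: F_def)
  have qlim: "(\<lambda>n. q n t) \<longlonglongrightarrow> f' t" if t: "t \<in> {a..<b} - N" for t
  proof -
    have "\<forall>\<^sub>F n in sequentially. h n < b - t"
      using order_tendstoD(2)[OF h0, of "b - t"] t by auto
    hence ev: "\<forall>\<^sub>F n in sequentially. t + h n \<in> {a..b}"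
      by eventually_elim (use t in \<open>auto intro: add_increasing2 less_imp_le[OF h(1)]\<close>)
    have "(\<lambda>n. (f (t + h n) - f t) /\<^sub>R h n) \<longlonglongrightarrow> f' t"
      by (rule forward_difference_quotients_tendsto[OF f' h0 h(1) ev]) (use t in auto)
    moreover have "\<forall>\<^sub>F n in sequentially. (f (t + h n) - f t) /\<^sub>R h n = q n t"
      using ev by eventually_elim (use t in \<open>auto simp: q_def F_def max_def min_def\<close>)
    ultimately show ?thesis by (rule Lim_transform_eventually)
  qed
  have neg: "negligible (insert b N)" using N by simp
  (* Convergence may fail at b, where the quotients of F vanish, and on N; both are cut out. *)
  define q' where "q' n t = (if t \<in> insert b N then 0 else q n t)" for n t
  define g where "g t = (if t \<in> insert b N then 0 else f' t)" for t
  have q'lim: "(\<lambda>n. q' n t) \<longlonglongrightarrow> g t" if "t \<in> {a..b}" for t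
    using qlim that by (auto simp: q'_def g_def)
  have q'_le: "norm (q' n t) \<le> L" for n t
  proof -
    have "norm (q n t) \<le> L * h n / h n"
      using lipF[of "t + h n" t] h(1)[of n] by (simp add: q_def divide_inverse mult.commute[of "inverse _"])
    thus ?thesis
      using h(1)[of n] lipschitz_on_nonneg[OF L] by (simp add: q'_def)
  qed
  have int_g: "(g has_integral (f b - f a)) {a..b}"
  proof (rule has_integral_dominated_convergence)
    show "(q' n has_integral Q n) {a..b}" for n
    proof (rule has_integral_spike[OF neg])
      show "(q n has_integral Q n) {a..b}"
        unfolding Q_def q_def
        by (intro integrable_integral integrable_continuous_interval continuous_intros
              continuous_on_compose2[OF contF[of UNIV]]) auto
    qed (simp add: q'_def)
  qed (use q'lim q'_le Qlim in auto)
  thus "(f' has_integral (f b - f a)) {a..b}"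
    by (rule has_integral_spike[OF neg, rotated]) (auto simp: g_def)
  have "norm (g t) \<le> L" if "t \<in> {a..b}" for t
    using tendsto_norm[OF q'lim[OF that]] q'_le by (intro LIMSEQ_le_const2) auto
  hence "g absolutely_integrable_on {a..b}"
    using int_g by (intro absolutely_integrable_integrable_bound[of _ _ "\<lambda>_. L"]) auto
  thus "f' absolutely_integrable_on {a..b}"
    by (rule absolutely_integrable_spike[OF _ neg]) (auto simp: g_def)
qed

section \<open>Horizontal curves joining two points\<close>

lemma horizontal_curve_if_C1:
  fixes \<gamma> \<gamma>' :: "real \<Rightarrow> heisenberg"
  assumes ab: "a < b" and cont: "continuous_on {a..b} \<gamma>'"
    and der: "\<And>t. t \<in> {a..b} \<Longrightarrow> (\<gamma> has_vector_derivative \<gamma>' t) (at t within {a..b})"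
    and hor: "\<And>t. t \<in> {a..b} \<Longrightarrow> \<gamma>' t $ 3 = (\<gamma>' t $ 1 * \<gamma> t $ 2 - \<gamma>' t $ 2 * \<gamma> t $ 1) / 2"
  shows "horizontal_curve a b \<gamma>"
proof -
  have "compact (\<gamma>' ` {a..b})"
    using cont by (intro compact_continuous_image) auto
  then obtain C where C: "C > 0" "\<And>t. t \<in> {a..b} \<Longrightarrow> norm (\<gamma>' t) \<le> C"
    using compact_imp_bounded bounded_pos by (metis imageI)
  have "C-lipschitz_on {a..b} \<gamma>"
  proof (rule bounded_derivative_imp_lipschitz)
    fix t assume t: "t \<in> {a..b}"
    show "(\<gamma> has_derivative (\<lambda>s. s *\<^sub>R \<gamma>' t)) (at t within {a..b})"
      using der[OF t] by (simp add: has_vector_derivative_def)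
    show "onorm (\<lambda>s. s *\<^sub>R \<gamma>' t) \<le> C"
      by (rule onorm_le) (use C(2)[OF t] in \<open>simp add: mult.commute[of C] mult_left_mono\<close>)
  qed (use C in auto)
  moreover have "\<gamma> differentiable (at t within {a..b})"
    "vector_derivative \<gamma> (at t within {a..b})
          \<in> span {vector [1, 0, \<gamma> t $ 2 / 2], vector [0, 1, - (\<gamma> t $ 1 / 2)]}" if t: "t \<in> {a..b}" for t
  proof -
    show "\<gamma> differentiable (at t within {a..b})"
      using der[OF t] by (rule differentiableI_vector)
    have "vector_derivative \<gamma> (at t within {a..b}) = \<gamma>' t"
      using vector_derivative_within_cbox[of a b t \<gamma> "\<gamma>' t"] der[OF t] ab t by simp
    also have "\<gamma>' t = \<gamma>' t $ 1 *\<^sub>R vector [1, 0, \<gamma> t $ 2 / 2] + \<gamma>' t $ 2 *\<^sub>R vector [0, 1, - (\<gamma> t $ 1 / 2)]"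
      using hor[OF t] by (simp add: vec_eq_iff forall_3 field_simps)
    also have "\<dots> \<in> span {vector [1, 0, \<gamma> t $ 2 / 2], vector [0, 1, - (\<gamma> t $ 1 / 2)]}"
      by (intro span_add span_mul span_base) auto
    finally show "vector_derivative \<gamma> (at t within {a..b})
          \<in> span {vector [1, 0, \<gamma> t $ 2 / 2], vector [0, 1, - (\<gamma> t $ 1 / 2)]}" .
  qed
  ultimately show ?thesis
    unfolding horizontal_curve_def using ab by auto
qed

text \<open>The infimum in \<open>d_C\<close> is only meaningful over a nonempty set, so a connecting curve is needed
  before \<open>d_C\<close> can be bounded from below. The third coordinate of a horizontal curve is determined
  by the enclosed area of its planar projection. Perturbing the segment between the projected end
  points by \<open>t (1 - t)\<close> in the first coordinate and by \<open>\<beta> t (1 - t) (1 - 2 t)\<close> in the second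
  changes this area by an affine function of \<open>\<beta>\<close> with slope \<open>1/30\<close>, so a suitable \<open>\<beta>\<close> reaches
  the prescribed height.\<close>

lemma horizontal_curve_exists: "\<exists>\<gamma>. horizontal_curve 0 1 \<gamma> \<and> \<gamma> 0 = x \<and> \<gamma> 1 = y"
proof -
  define A where "A = y $ 1 - x $ 1 + 1"
  define b where "b = y $ 2 - x $ 2"
  define \<beta> where "\<beta> = 30 * (y $ 3 - x $ 3 - (A * x $ 2 - b * x $ 1 - x $ 2 - b / 3) / 2)"
  define p where "p t = x $ 1 + A * t - t ^ 2" for t :: real
  define q where "q t = x $ 2 + b * t + \<beta> * (t - 3 * t ^ 2 + 2 * t ^ 3)" for t :: real
  (* The explicit antiderivative of (p' q - q' p) / 2 with r 0 = x $ 3. *)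
  define r where "r t = x $ 3 + ((A * x $ 2 - b * x $ 1) * t - x $ 2 * t ^ 2 - b / 3 * t ^ 3
        + \<beta> * (- x $ 1 * t + 3 * x $ 1 * t ^ 2 + (A - 1 / 3 - 2 * x $ 1) * t ^ 3
            - A * t ^ 4 + 2 / 5 * t ^ 5)) / 2" for t :: real
  define p' where "p' t = A - 2 * t" for t :: real
  define q' where "q' t = b + \<beta> * (1 - 6 * t + 6 * t ^ 2)" for t :: real
  define r' where "r' t = (p' t * q t - q' t * p t) / 2" for t
  have p: "(p has_real_derivative p' t) (at t within S)" for t S
    unfolding p_def[abs_def] p'_def by (auto intro!: derivative_eq_intros)
  have q: "(q has_real_derivative q' t) (at t within S)" for t S
    unfolding q_def[abs_def] q'_def by (auto intro!: derivative_eq_intros)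
  have r: "(r has_real_derivative r' t) (at t within S)" for t S
  proof -
    have "r' t = (((A * x $ 2 - b * x $ 1) - 2 * x $ 2 * t - b * t ^ 2
        + \<beta> * (- x $ 1 + 6 * x $ 1 * t + (3 * A - 1 - 6 * x $ 1) * t ^ 2
            - 4 * A * t ^ 3 + 2 * t ^ 4)) / 2)"
      unfolding r'_def p'_def q'_def p_def q_def by algebra
    thus ?thesis
      unfolding r_def[abs_def] by (auto intro!: derivative_eq_intros simp: field_simps)
  qed
  define \<gamma> :: "real \<Rightarrow> heisenberg"
    where "\<gamma> t = p t *\<^sub>R axis 1 1 + q t *\<^sub>R axis 2 1 + r t *\<^sub>R axis 3 1" for t
  define \<gamma>' :: "real \<Rightarrow> heisenberg"
    where "\<gamma>' t = p' t *\<^sub>R axis 1 1 + q' t *\<^sub>R axis 2 1 + r' t *\<^sub>R axis 3 1" for t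
  have comp [simp]: "\<gamma> t $ 1 = p t" "\<gamma> t $ 2 = q t" "\<gamma> t $ 3 = r t"
    "\<gamma>' t $ 1 = p' t" "\<gamma>' t $ 2 = q' t" "\<gamma>' t $ 3 = r' t" for t
    by (simp_all add: \<gamma>_def \<gamma>'_def axis_def)
  have "horizontal_curve 0 1 \<gamma>"
  proof (rule horizontal_curve_if_C1)
    show "continuous_on {0..1} \<gamma>'"
      unfolding \<gamma>'_def r'_def p'_def q'_def p_def q_def by (intro continuous_intros) auto
    show "(\<gamma> has_vector_derivative \<gamma>' t) (at t within {0..1})" for t
    proof -
      have smul: "((\<lambda>t. f t *\<^sub>R v) has_vector_derivative d *\<^sub>R v) (at t within {0..1})"
        if "(f has_real_derivative d) (at t within {0..1})" for f d and v :: heisenberg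
        using has_vector_derivative_scaleR[OF that has_vector_derivative_const[of v]] by simp
      show ?thesis
        unfolding \<gamma>_def[abs_def] \<gamma>'_def by (intro has_vector_derivative_add smul p q r)
    qed
  qed (auto simp: r'_def)
  moreover have "r 1 = y $ 3"
    by (simp add: r_def \<beta>_def field_simps)
  hence "\<gamma> 0 = x" "\<gamma> 1 = y"
    by (simp_all add: vec_eq_iff forall_3 p_def q_def r_def A_def b_def)
  ultimately show ?thesis by blast
qed

section \<open>The thin lens\<close>

text \<open>The functions \<open>g\<^sub>+\<close> and \<open>g\<^sub>-\<close> of the introduction are \<open>gap h 1\<close> and \<open>gap h (- 1)\<close>.\<close>

definition gap :: "real \<Rightarrow> real \<Rightarrow> heisenberg \<Rightarrow> real" where
  "gap h \<sigma> x = h * (1 - (x $ 2)\<^sup>2 - (x $ 3)\<^sup>2) - \<sigma> * x $ 1"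

definition lens :: "real \<Rightarrow> heisenberg set" where
  "lens h = {x. 0 < gap h 1 x \<and> 0 < gap h (- 1) x}"

text \<open>On the closed lens the quadratic part of the gaps is nonnegative, being an upper bound for
  \<open>\<bar>x\<^sub>1\<bar>\<close>; this confines all three coordinates.\<close>

lemma gap_nonneg_bounds:
  assumes "0 < h" "h \<le> 1" "0 \<le> gap h 1 x" "0 \<le> gap h (- 1) x"
  shows "\<bar>x $ i\<bar> \<le> 1"
proof -
  have "\<bar>x $ 1\<bar> \<le> h * (1 - (x $ 2)\<^sup>2 - (x $ 3)\<^sup>2)"
    using assms by (simp add: gap_def abs_le_iff)
  moreover from this have q: "0 \<le> 1 - (x $ 2)\<^sup>2 - (x $ 3)\<^sup>2"
    using assms(1) by (meson abs_ge_zero order_trans zero_le_mult_iff not_le)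
  moreover have "h * (1 - (x $ 2)\<^sup>2 - (x $ 3)\<^sup>2) \<le> 1 * 1"
    using assms q by (intro mult_mono) auto
  moreover have "(x $ 2)\<^sup>2 \<le> 1" "(x $ 3)\<^sup>2 \<le> 1"
    using q zero_le_power2[of "x $ 2"] zero_le_power2[of "x $ 3"] by linarith+
  ultimately show ?thesis
    using exhaust_3[of i] by (auto simp: abs_square_le_1)
qed

lemma continuous_on_gap [continuous_intros]: "continuous_on S (gap h \<sigma>)"
  unfolding gap_def by (intro continuous_intros)

lemma open_lens: "open (lens h)"
  unfolding lens_def by (intro open_Collect_conj open_Collect_less continuous_intros)

lemma bounded_lens:
  assumes "0 < h" "h \<le> 1" shows "bounded (lens h)"
proof (rule boundedI)
  fix x assume "x \<in> lens h"
  hence "\<bar>x $ i\<bar> \<le> 1" for i using gap_nonneg_bounds[OF assms, of x i] by (auto simp: lens_def)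
  hence "norm x \<le> (\<Sum>i\<in>(UNIV :: 3 set). 1)" by (intro order_trans[OF norm_le_l1_cart] sum_mono) simp
  thus "norm x \<le> 3" by simp
qed

text \<open>The gaps are concave; the defect in the concavity inequality is an explicit multiple of
  squares.\<close>

lemma convex_lens:
  assumes "0 < h" shows "convex (lens h)"
proof -
  have "convex {x. 0 < gap h \<sigma> x}" for \<sigma>
  proof (rule convexI)
    fix x y :: heisenberg and s t :: real
    assume xy: "x \<in> {x. 0 < gap h \<sigma> x}" "y \<in> {x. 0 < gap h \<sigma> x}" and st: "0 \<le> s" "0 \<le> t" "s + t = 1"
    have "gap h \<sigma> (s *\<^sub>R x + t *\<^sub>R y) = s * gap h \<sigma> x + t * gap h \<sigma> y
      + h * (s * t * ((x $ 2 - y $ 2)\<^sup>2 + (x $ 3 - y $ 3)\<^sup>2))"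
    proof -
      have t: "t = 1 - s" using st by simp
      show ?thesis unfolding gap_def t by (simp add: power2_eq_square) algebra
    qed
    moreover have "0 < s * gap h \<sigma> x + t * gap h \<sigma> y"
      using convex_bound_lt[of "- gap h \<sigma> x" 0 "- gap h \<sigma> y" s t] xy st by simp
    moreover have "0 \<le> h * (s * t * ((x $ 2 - y $ 2)\<^sup>2 + (x $ 3 - y $ 3)\<^sup>2))"
      using assms st by simp
    ultimately show "s *\<^sub>R x + t *\<^sub>R y \<in> {x. 0 < gap h \<sigma> x}" by simp
  qed
  thus ?thesis unfolding lens_def Collect_conj_eq by (intro convex_Int)
qed

section \<open>The distance to the boundary of the lens\<close>

lemma gap_has_vector_derivative:
  assumes "(\<gamma> has_vector_derivative v) (at t within S)"
  shows "((\<lambda>t. gap h \<sigma> (\<gamma> t)) has_vector_derivative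
    - 2 * h * (\<gamma> t $ 2 * v $ 2 + \<gamma> t $ 3 * v $ 3) - \<sigma> * v $ 1) (at t within S)"
proof -
  have "((\<lambda>t. \<gamma> t $ i) has_real_derivative v $ i) (at t within S)" for i
    using bounded_linear.has_vector_derivative[OF bounded_linear_vec_nth assms]
    by (simp add: has_real_derivative_iff_has_vector_derivative)
  thus ?thesis
    unfolding gap_def has_real_derivative_iff_has_vector_derivative[symmetric]
    by (auto intro!: derivative_eq_intros simp: algebra_simps)
qed

lemma horizontal_span:
  assumes "v \<in> span {vector [1, 0, q / 2], vector [0, 1, - (p / 2)] :: heisenberg}"
  shows "v $ 3 = (v $ 1 * q - v $ 2 * p) / 2"
  using assms by (auto simp: span_insert span_breakdown_eq vec_eq_iff forall_3 algebra_simps)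

text \<open>Along a curve whose coordinates stay in \<open>[-1, 1]\<close>, each of \<open>\<bar>v\<^sub>1\<bar>\<close>, \<open>\<bar>v\<^sub>2\<bar>\<close>, \<open>\<bar>v\<^sub>3\<bar>\<close> is at most the
  speed \<open>s = sqrt (v\<^sub>1\<^sup>2 + v\<^sub>2\<^sup>2)\<close> that is integrated in the horizontal length. The derivative
  \<open>- 2 h (x\<^sub>2 v\<^sub>2 + x\<^sub>3 v\<^sub>3) - \<sigma> v\<^sub>1\<close> of the gap is therefore at most \<open>(1 + 4 h) s\<close> in absolute value.\<close>

lemma gap_decrease_le_length:
  assumes h: "0 < h" "h \<le> 1" and \<sigma>: "\<bar>\<sigma>\<bar> = 1" and hor: "horizontal_curve a b \<gamma>"
    and \<tau>: "a < \<tau>" "\<tau> \<le> b"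
    and bnd: "\<And>t i. t \<in> {a..\<tau>} \<Longrightarrow> \<bar>\<gamma> t $ i\<bar> \<le> 1"
  shows "gap h \<sigma> (\<gamma> a) - gap h \<sigma> (\<gamma> \<tau>) \<le> (1 + 4 * h) * horizontal_length a b \<gamma>"
proof -
  define v where "v t = vector_derivative \<gamma> (at t within {a..b})" for t
  define s where "s t = sqrt ((v t $ 1)\<^sup>2 + (v t $ 2)\<^sup>2)" for t
  from hor obtain L where ab: "a < b" and L: "L-lipschitz_on {a..b} \<gamma>"
    and ae: "AE t in lebesgue. t \<in> {a..b} \<longrightarrow> \<gamma> differentiable (at t within {a..b}) \<and>
        v t \<in> span {vector [1, 0, \<gamma> t $ 2 / 2], vector [0, 1, - (\<gamma> t $ 1 / 2)]}"
    unfolding horizontal_curve_def v_def by blast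
  from ae obtain N where N: "N \<in> null_sets lebesgue"
    and ae': "\<And>t. t \<in> {a..b} - N \<Longrightarrow> \<gamma> differentiable (at t within {a..b}) \<and>
        v t \<in> span {vector [1, 0, \<gamma> t $ 2 / 2], vector [0, 1, - (\<gamma> t $ 1 / 2)]}"
    unfolding eventually_ae_filter by (auto simp: subset_eq)
  have neg: "negligible N" using N by (simp add: negligible_iff_null_sets)
  have dv: "(\<gamma> has_vector_derivative v t) (at t within {a..b})" if "t \<in> {a..b} - N" for t
    using ae'[OF that] unfolding v_def by (simp flip: vector_derivative_works)
  have v3: "v t $ 3 = (v t $ 1 * \<gamma> t $ 2 - v t $ 2 * \<gamma> t $ 1) / 2" if "t \<in> {a..b} - N" for t
    using ae'[OF that] by (intro horizontal_span) auto
  (* A Henstock-Kurzweil integral of a non-integrable function is 0 by convention, so that the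
     length controls anything only because the speed is integrable. *)
  have int_s: "s integrable_on {a..b}"
  proof -
    have abs_v: "v absolutely_integrable_on {a..b}"
      by (rule lipschitz_fundamental_theorem_of_calculus(2)[OF ab L neg dv])
    have "bounded_linear (\<lambda>x::heisenberg. (x $ 1, x $ 2))"
      by (intro bounded_linear_Pair bounded_linear_vec_nth)
    from absolutely_integrable_linear[OF abs_v this]
    have "(\<lambda>t. norm (v t $ 1, v t $ 2)) integrable_on {a..b}"
      by (simp add: absolutely_integrable_on_def o_def)
    thus ?thesis by (simp add: s_def[abs_def] norm_Pair)
  qed
  have s0: "s t \<ge> 0" for t by (simp add: s_def)
  define d where "d t = - 2 * h * (\<gamma> t $ 2 * v t $ 2 + \<gamma> t $ 3 * v t $ 3) - \<sigma> * v t $ 1" for t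
  have d_le: "- d t \<le> (1 + 4 * h) * s t" if t: "t \<in> {a..\<tau>} - N" for t
  proof -
    have v1: "\<bar>v t $ 1\<bar> \<le> s t" and v2: "\<bar>v t $ 2\<bar> \<le> s t"
      by (simp_all add: s_def real_le_rsqrt)
    have prod: "\<bar>\<gamma> t $ i * w\<bar> \<le> \<bar>w\<bar>" for i w
      using bnd[of t i] t by (auto simp: abs_mult intro: mult_left_le_one_le)
    have "\<bar>v t $ 3\<bar> \<le> s t"
      using prod[of 2 "v t $ 1"] prod[of 1 "v t $ 2"] v1 v2 v3[of t] t \<tau> by (auto simp: mult.commute)
    hence "\<bar>\<gamma> t $ 2 * v t $ 2 + \<gamma> t $ 3 * v t $ 3\<bar> \<le> 2 * s t"
      using prod[of 2 "v t $ 2"] prod[of 3 "v t $ 3"] v2 by linarith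
    hence "\<bar>2 * h * (\<gamma> t $ 2 * v t $ 2 + \<gamma> t $ 3 * v t $ 3)\<bar> \<le> 2 * h * (2 * s t)"
      using h by (simp add: abs_mult)
    moreover have "\<bar>\<sigma> * v t $ 1\<bar> \<le> s t" using \<sigma> v1 by (simp add: abs_mult)
    ultimately show ?thesis unfolding d_def by (simp add: algebra_simps)
  qed
  have "(d has_integral gap h \<sigma> (\<gamma> \<tau>) - gap h \<sigma> (\<gamma> a)) {a..\<tau>}"
  proof (rule lipschitz_fundamental_theorem_of_calculus(1)[OF \<tau>(1) _ neg])
    show "((\<lambda>t. gap h \<sigma> (\<gamma> t)) has_vector_derivative d t) (at t within {a..\<tau>})"
      if "t \<in> {a..\<tau>} - N" for t
      unfolding d_def
      by (rule gap_has_vector_derivative, rule has_vector_derivative_within_subset[OF dv])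
        (use that \<tau> in auto)
    show "(5 * L)-lipschitz_on {a..\<tau>} (\<lambda>t. gap h \<sigma> (\<gamma> t))"
    proof (rule lipschitz_onI)
      fix t r assume tr: "t \<in> {a..\<tau>}" "r \<in> {a..\<tau>}"
      define e where "e = L * \<bar>t - r\<bar>"
      have lip: "\<bar>\<gamma> t $ i - \<gamma> r $ i\<bar> \<le> e" for i
        using lipschitz_onD[OF L, of t r] tr \<tau> component_le_norm_cart[of "\<gamma> t - \<gamma> r" i]
        by (simp add: dist_norm e_def)
      have sq: "\<bar>(\<gamma> t $ i)\<^sup>2 - (\<gamma> r $ i)\<^sup>2\<bar> \<le> 2 * e" for i
      proof -
        have "\<bar>\<gamma> t $ i + \<gamma> r $ i\<bar> * \<bar>\<gamma> t $ i - \<gamma> r $ i\<bar> \<le> 2 * e"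
          using bnd[OF tr(1), of i] bnd[OF tr(2), of i] lip by (intro mult_mono) auto
        thus ?thesis by (simp add: power2_eq_square algebra_simps flip: abs_mult)
      qed
      have "gap h \<sigma> (\<gamma> t) - gap h \<sigma> (\<gamma> r) = - (h * (((\<gamma> t $ 2)\<^sup>2 - (\<gamma> r $ 2)\<^sup>2)
          + ((\<gamma> t $ 3)\<^sup>2 - (\<gamma> r $ 3)\<^sup>2))) - \<sigma> * (\<gamma> t $ 1 - \<gamma> r $ 1)"
        by (simp add: gap_def algebra_simps)
      moreover have "\<bar>h * (((\<gamma> t $ 2)\<^sup>2 - (\<gamma> r $ 2)\<^sup>2) + ((\<gamma> t $ 3)\<^sup>2 - (\<gamma> r $ 3)\<^sup>2))\<bar> \<le> 1 * (4 * e)"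
        unfolding abs_mult using h sq[of 2] sq[of 3] by (intro mult_mono) auto
      moreover have "\<bar>\<sigma> * (\<gamma> t $ 1 - \<gamma> r $ 1)\<bar> \<le> e"
        using \<sigma> lip[of 1] by (simp add: abs_mult)
      ultimately show "dist (gap h \<sigma> (\<gamma> t)) (gap h \<sigma> (\<gamma> r)) \<le> 5 * L * dist t r"
        by (simp add: dist_real_def e_def)
    qed (use lipschitz_on_nonneg[OF L] in auto)
  qed
  from has_integral_neg[OF this]
  have "((\<lambda>t. - d t) has_integral gap h \<sigma> (\<gamma> a) - gap h \<sigma> (\<gamma> \<tau>)) {a..\<tau>}"
    unfolding minus_diff_eq .
  hence "((\<lambda>t. if t \<in> N then 0 else - d t) has_integral gap h \<sigma> (\<gamma> a) - gap h \<sigma> (\<gamma> \<tau>)) {a..\<tau>}"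
    by (rule has_integral_spike[OF neg, rotated]) auto
  hence "gap h \<sigma> (\<gamma> a) - gap h \<sigma> (\<gamma> \<tau>) \<le> integral {a..\<tau>} (\<lambda>t. (1 + 4 * h) * s t)"
  proof (rule has_integral_le)
    have "s integrable_on {a..\<tau>}"
      by (rule integrable_on_subinterval[OF int_s]) (use \<tau> in auto)
    thus "((\<lambda>t. (1 + 4 * h) * s t) has_integral integral {a..\<tau>} (\<lambda>t. (1 + 4 * h) * s t)) {a..\<tau>}"
      by (intro integrable_integral integrable_on_mult_right)
  qed (use d_le s0 h in auto)
  also have "\<dots> \<le> integral {a..b} (\<lambda>t. (1 + 4 * h) * s t)"
    using int_s s0 h \<tau> ab
    by (intro integral_subset_le integrable_on_mult_right integrable_on_subinterval[OF int_s]) auto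
  also have "\<dots> = (1 + 4 * h) * horizontal_length a b \<gamma>"
    by (simp add: horizontal_length_def s_def v_def)
  finally show ?thesis .
qed

text \<open>A curve that ends outside the lens may move arbitrarily far away, where the velocity bound
  fails; only its part up to the first exit time \<open>\<tau>\<close> is used. There both gaps are still
  nonnegative by continuity and one of them is zero.\<close>

lemma gap_le_horizontal_length:
  assumes h: "0 < h" "h \<le> 1" and x: "\<gamma> a \<in> lens h" and y: "\<gamma> b \<notin> lens h"
    and hor: "horizontal_curve a b \<gamma>"
  shows "min (gap h 1 (\<gamma> a)) (gap h (- 1) (\<gamma> a)) \<le> (1 + 4 * h) * horizontal_length a b \<gamma>"
proof -
  from hor obtain L where ab: "a < b" and L: "L-lipschitz_on {a..b} \<gamma>"
    unfolding horizontal_curve_def by blast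
  have cont: "continuous_on {a..b} \<gamma>" by (rule lipschitz_on_continuous_on[OF L])
  have cg: "continuous_on {a..b} (\<lambda>t. gap h \<sigma> (\<gamma> t))" for \<sigma>
    by (rule continuous_on_compose2[OF continuous_on_gap[of UNIV] cont]) auto
  define T where "T = {t \<in> {a..b}. min (gap h 1 (\<gamma> t)) (gap h (- 1) (\<gamma> t)) \<le> 0}"
  have T: "t \<in> T \<longleftrightarrow> t \<in> {a..b} \<and> \<gamma> t \<notin> lens h" for t
    by (auto simp: T_def lens_def min_le_iff_disj not_less)
  have "closed T"
    unfolding T_def by (intro continuous_on_closed_Collect_le continuous_intros cg)
  moreover have "T \<noteq> {}" "bdd_below T" using T[of b] T y ab by (auto simp: bdd_below_def)
  ultimately have \<tau>T: "Inf T \<in> T" by (intro closed_contains_Inf)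
  define \<tau> where "\<tau> = Inf T"
  have \<tau>: "a < \<tau>" "\<tau> \<le> b" using \<tau>T x by (auto simp: T \<tau>_def order_le_less)
  have before: "\<gamma> t \<in> lens h" if "t \<in> {a..<\<tau>}" for t
    using that \<tau> cInf_lower[OF _ \<open>bdd_below T\<close>, of t] T[of t] by (auto simp: \<tau>_def)
  have nonneg: "0 \<le> gap h \<sigma> (\<gamma> t)" if "t \<in> {a..\<tau>}" "\<sigma> \<in> {1, - 1}" for t \<sigma>
  proof (rule continuous_ge_on_closure[where f = "\<lambda>t. gap h \<sigma> (\<gamma> t)"])
    show "continuous_on (closure {a..<\<tau>}) (\<lambda>t. gap h \<sigma> (\<gamma> t))"
      using \<tau> by (intro continuous_on_subset[OF cg]) auto
    show "t \<in> closure {a..<\<tau>}" using that(1) \<tau> by simp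
    show "0 \<le> gap h \<sigma> (\<gamma> r)" if "r \<in> {a..<\<tau>}" for r
      using before[OF that] \<open>\<sigma> \<in> {1, - 1}\<close> by (auto simp: lens_def)
  qed
  from \<tau>T obtain \<sigma> where \<sigma>: "\<sigma> \<in> {1, - 1}" "gap h \<sigma> (\<gamma> \<tau>) \<le> 0"
    by (auto simp: T_def \<tau>_def min_le_iff_disj)
  have "gap h \<sigma> (\<gamma> a) - gap h \<sigma> (\<gamma> \<tau>) \<le> (1 + 4 * h) * horizontal_length a b \<gamma>"
    using \<sigma> by (intro gap_decrease_le_length[OF h _ hor \<tau>] gap_nonneg_bounds[OF h] nonneg) auto
  thus ?thesis using \<sigma> by auto
qed

lemma gap_le_d_C:
  assumes h: "0 < h" "h \<le> 1" and x: "x \<in> lens h" and y: "y \<notin> lens h"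
  shows "min (gap h 1 x) (gap h (- 1) x) / (1 + 4 * h) \<le> d_C x y"
  unfolding d_C_def
proof (rule cInf_greatest)
  show "{horizontal_length a b \<gamma> |a b \<gamma>. horizontal_curve a b \<gamma> \<and> \<gamma> a = x \<and> \<gamma> b = y} \<noteq> {}"
    using horizontal_curve_exists[of x y] by blast
next
  fix l assume "l \<in> {horizontal_length a b \<gamma> |a b \<gamma>. horizontal_curve a b \<gamma> \<and> \<gamma> a = x \<and> \<gamma> b = y}"
  then obtain a b \<gamma> where l: "l = horizontal_length a b \<gamma>"
    and \<gamma>: "horizontal_curve a b \<gamma>" "\<gamma> a = x" "\<gamma> b = y" by blast
  have "min (gap h 1 x) (gap h (- 1) x) \<le> (1 + 4 * h) * l"
    using gap_le_horizontal_length[OF h _ _ \<gamma>(1)] x y \<gamma> l by simp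
  thus "min (gap h 1 x) (gap h (- 1) x) / (1 + 4 * h) \<le> l"
    using h by (simp add: divide_le_eq mult.commute)
qed

lemma gap_le_delta_C:
  assumes h: "0 < h" "h \<le> 1" and x: "x \<in> lens h"
  shows "min (gap h 1 x) (gap h (- 1) x) / (1 + 4 * h) \<le> delta_C (lens h) x"
  unfolding delta_C_def
proof (rule cINF_greatest)
  have "lens h \<noteq> UNIV" using bounded_lens[OF h] not_bounded_UNIV by metis
  thus "frontier (lens h) \<noteq> {}" using x frontier_not_empty by blast
  show "min (gap h 1 x) (gap h (- 1) x) / (1 + 4 * h) \<le> d_C x y" if "y \<in> frontier (lens h)" for y
    using that open_lens[of h] by (intro gap_le_d_C[OF h x]) (auto simp: frontier_def interior_open)
qed

section \<open>Integration along the flow of the first vector field\<close>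

text \<open>The flow of \<open>X\<^sub>1\<close>: its integral curves are straight lines because \<open>x\<^sub>2\<close> is constant along
  them. It is also right translation by the one-parameter subgroup \<open>t \<mapsto> (t, 0, 0)\<close>.\<close>

definition flow :: "real \<Rightarrow> heisenberg \<Rightarrow> heisenberg" where
  "flow t x = x + t *\<^sub>R vector [1, 0, x $ 2 / 2]"

lemma flow_nth [simp]: "flow t x $ 1 = x $ 1 + t" "flow t x $ 2 = x $ 2"
  "flow t x $ 3 = x $ 3 + t * x $ 2 / 2"
  by (simp_all add: flow_def)

lemma flow_flow [simp]: "flow s (flow t x) = flow (s + t) x"
  by (simp add: vec_eq_iff forall_3 algebra_simps add_divide_distrib)

lemma flow_0 [simp]: "flow 0 x = x"
  by (simp add: flow_def)

lemma continuous_on_flow [continuous_intros]: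
  assumes "continuous_on S f" "continuous_on S g"
  shows "continuous_on S (\<lambda>z. flow (f z) (g z))"
proof -
  have "flow t x = x + t *\<^sub>R axis 1 1 + (t * x $ 2 / 2) *\<^sub>R axis 3 1" for t x
    by (simp add: vec_eq_iff forall_3 axis_def)
  thus ?thesis by (auto intro!: continuous_intros assms)
qed

lemma integrable_continuous_compact_support:
  fixes f :: "'a::euclidean_space \<Rightarrow> 'b::euclidean_space"
  assumes "continuous_on UNIV f" "compact S" "\<And>x. x \<notin> S \<Longrightarrow> f x = 0"
  shows "integrable lebesgue f"
proof -
  have "integrable lborel (\<lambda>x. indicator S x *\<^sub>R f x)"
    using assms by (intro borel_integrable_compact) (auto intro: continuous_on_subset)
  moreover have "(\<lambda>x. indicator S x *\<^sub>R f x) = f"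
    using assms(3) by (auto simp: indicator_def fun_eq_iff)
  ultimately show ?thesis by (simp add: integrable_completion)
qed

text \<open>Each flow map is an affine shear of determinant \<open>1\<close>.\<close>

lemma integral_flow:
  fixes w :: "heisenberg \<Rightarrow> real"
  assumes w: "integrable lebesgue w"
  shows "integrable lebesgue (\<lambda>x. w (flow t x))"
    and "(\<integral>x. w (flow t x) \<partial>lebesgue) = (\<integral>x. w x \<partial>lebesgue)"
proof -
  define g' :: "heisenberg \<Rightarrow> heisenberg" where "g' y = y + (t * y $ 2 / 2) *\<^sub>R axis 3 1" for y
  have flow': "flow t x = g' x + t *\<^sub>R axis 1 1" for x
    by (simp add: vec_eq_iff forall_3 axis_def g'_def)
  have "bounded_linear g'"
    unfolding g'_def[abs_def]
    by (intro bounded_linear_add bounded_linear_ident bounded_linear_compose[OF bounded_linear_scaleR_left]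
      bounded_linear_compose[OF bounded_linear_divide] bounded_linear_compose[OF bounded_linear_mult_right] bounded_linear_vec_nth)
  hence der: "(flow t has_derivative g') (at x within UNIV)" for x
    unfolding flow'[abs_def] by (auto intro!: derivative_eq_intros bounded_linear_imp_has_derivative)
  have det: "det (matrix g') = 1"
    by (simp add: det_3 matrix_def g'_def axis_def)
  have inj: "inj_on (flow t) UNIV"
    by (rule inj_on_inverseI[of _ "flow (- t)"]) simp
  have surj: "range (flow t) = UNIV"
    by (rule surjI[of _ "flow (- t)"]) simp
  have abs_w: "w absolutely_integrable_on UNIV"
    using w by (simp add: set_integrable_def)
  (* The change of variables theorem concerns vector-valued integrands. *)
  define f :: "heisenberg \<Rightarrow> real^1" where "f x = vec (w x)" for x
  have "f absolutely_integrable_on (range (flow t)) \<and> integral (range (flow t)) f = vec (integral UNIV w)"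
    using abs_w unfolding surj f_def 
    by (simp add: absolutely_integrable_on_1_iff integral_on_1_eq)
  hence "(\<lambda>x. f (flow t x)) absolutely_integrable_on UNIV \<and> integral UNIV (\<lambda>x. f (flow t x)) = vec (integral UNIV w)"
    using has_absolute_integral_change_of_variables[OF _ der inj, of f "vec (integral UNIV w)"] det by simp
  hence *: "(\<lambda>x. w (flow t x)) absolutely_integrable_on UNIV" "integral UNIV (\<lambda>x. w (flow t x)) = integral UNIV w"
    unfolding f_def by (simp_all add: absolutely_integrable_on_1_iff integral_on_1_eq vec_eq_iff)
  show "integrable lebesgue (\<lambda>x. w (flow t x))"
    using *(1) by (simp add: set_integrable_def)
  show "(\<integral>x. w (flow t x) \<partial>lebesgue) = (\<integral>x. w x \<partial>lebesgue)"
    using set_lebesgue_integral_eq_integral(2)[OF *(1)] set_lebesgue_integral_eq_integral(2)[OF abs_w] *(2)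
    by (simp add: set_lebesgue_integral_def)
qed

text \<open>Integration by parts for \<open>X\<^sub>1\<close> without boundary term. Differentiability along the flow lines
  suffices: the difference quotients along the flow have integral zero by invariance of the measure,
  are bounded by the mean value theorem, and are supported in one fixed ball, so dominated
  convergence applies.\<close>

lemma integral_flow_derivative_eq_0:
  fixes w D :: "heisenberg \<Rightarrow> real"
  assumes cont: "continuous_on UNIV w" and supp: "\<And>x. w x \<noteq> 0 \<Longrightarrow> norm x \<le> R"
    and der: "\<And>x. ((\<lambda>t. w (flow t x)) has_real_derivative D x) (at 0)"
    and bound: "\<And>x. \<bar>D x\<bar> \<le> M"
  shows "integrable lebesgue D" and "(\<integral>x. D x \<partial>lebesgue) = 0"
proof -
  define h :: "nat \<Rightarrow> real" where "h n = 1 / real (Suc n)" for n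
  have h: "h n > 0" "h n \<le> 1" for n by (auto simp: h_def)
  have h0: "h \<longlonglongrightarrow> 0" unfolding h_def by (rule LIMSEQ_Suc[OF lim_1_over_n])
  define q where "q n x = (w (flow (h n) x) - w x) / h n" for n x
  have int_w: "integrable lebesgue w"
    by (rule integrable_continuous_compact_support[OF cont compact_cball[of 0 R]]) (use supp in force)
  have int_q: "integrable lebesgue (q n)" for n
    unfolding q_def by (intro integrable_divide Bochner_Integration.integrable_diff integral_flow int_w)
  have integral_q: "(\<integral>x. q n x \<partial>lebesgue) = 0" for n
    unfolding q_def using int_w integral_flow[OF int_w] by simp
  have q_lim: "(\<lambda>n. q n x) \<longlonglongrightarrow> D x" for x
  proof -
    have "((\<lambda>t. (w (flow t x) - w x) / t) \<longlongrightarrow> D x) (at 0)"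
      using der[of x] by (simp add: has_field_derivative_iff)
    moreover have "filterlim h (at 0) sequentially"
      unfolding filterlim_at using h0 h(1) by (auto intro!: always_eventually simp: less_imp_neq[THEN not_sym])
    ultimately show ?thesis unfolding q_def by (rule filterlim_compose)
  qed
  have q_le: "\<bar>q n x\<bar> \<le> M" for n x
  proof -
    have "((\<lambda>t. w (flow t x)) has_real_derivative D (flow t x)) (at t)" for t
      using der[of "flow t x"] DERIV_shift[of "\<lambda>t. w (flow t x)" "D (flow t x)" 0 t] by simp
    hence "norm (w (flow (h n) x) - w (flow 0 x)) \<le> M * norm (h n - 0)"
      using bound by (intro field_differentiable_bound[of UNIV]) (auto simp: has_field_derivative_at_within)
    thus ?thesis using h(1)[of n] by (simp add: q_def divide_le_eq)
  qed
  have q_supp: "norm x \<le> 2 * R + 1" if "q n x \<noteq> 0" for n x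
  proof (cases "w x = 0")
    case False
    thus ?thesis using supp[of x] norm_ge_zero[of x] by linarith
  next
    case True
    define y where "y = flow (h n) x"
    have y: "norm y \<le> R" using that True by (intro supp) (auto simp: q_def y_def)
    have "x = flow (- h n) y" by (simp add: y_def)
    also have "flow (- h n) y = y - h n *\<^sub>R axis 1 1 - (h n * y $ 2 / 2) *\<^sub>R axis 3 1"
      by (simp add: vec_eq_iff forall_3 axis_def)
    also have "norm \<dots> \<le> norm y + h n + \<bar>h n * y $ 2\<bar> / 2"
      using h(1)[of n] by (intro order_trans[OF norm_triangle_ineq4] add_mono) auto
    also have "\<bar>h n * y $ 2\<bar> \<le> 1 * norm y"
      unfolding abs_mult using h[of n] by (intro mult_mono component_le_norm_cart) auto
    finally show ?thesis using y h(2)[of n] norm_ge_zero[of y] by linarith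
  qed
  define H :: "heisenberg \<Rightarrow> real" where "H x = M * indicator (cball 0 (2 * R + 1)) x" for x
  have int_H: "integrable lebesgue H"
    unfolding H_def by (intro integrable_mult_right) (simp flip: lmeasurable_iff_integrable)
  have q_H: "norm (q n x) \<le> H x" for n x
  proof -
    have "0 \<le> M" using bound[of x] by linarith
    thus ?thesis
      using q_le[of n x] q_supp[of n x] by (cases "q n x = 0") (auto simp: H_def indicator_def)
  qed
  have D: "D \<in> borel_measurable lebesgue"
    by (rule borel_measurable_LIMSEQ_real[OF q_lim]) (use int_q in auto)
  show "integrable lebesgue D"
    by (rule integrable_dominated_convergence[OF D _ int_H, of q]) (use q_lim q_H int_q in auto)
  have "(\<lambda>n. \<integral>x. q n x \<partial>lebesgue) \<longlonglongrightarrow> (\<integral>x. D x \<partial>lebesgue)"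
    by (rule integral_dominated_convergence[OF D _ int_H]) (use q_lim q_H int_q in auto)
  thus "(\<integral>x. D x \<partial>lebesgue) = 0"
    unfolding integral_q by (simp add: LIMSEQ_const_iff)
qed

section \<open>The Hardy inequality on the lens\<close>

lemma X1_is_derivative_along_flow:
  assumes "u differentiable (at x)"
  shows "((\<lambda>t. u (flow t x)) has_vector_derivative X1 u x) (at 0)"
proof -
  have u: "(u has_derivative frechet_derivative u (at x)) (at x)"
    using assms frechet_derivative_works by blast
  interpret bounded_linear "frechet_derivative u (at x)"
    using u by (rule has_derivative_bounded_linear)
  have vec: "vector [1, 0, x $ 2 / 2] = axis 1 1 + (x $ 2 / 2) *\<^sub>R (axis 3 1 :: heisenberg)"
    by (simp add: vec_eq_iff forall_3 axis_def)
  have "((\<lambda>t. flow t x) has_derivative (\<lambda>t. t *\<^sub>R vector [1, 0, x $ 2 / 2])) (at 0)"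
    unfolding flow_def by (auto intro!: derivative_eq_intros)
  from diff_chain_at[OF this, of u] u
  have "((\<lambda>t. u (flow t x)) has_derivative (\<lambda>t. frechet_derivative u (at x) (t *\<^sub>R vector [1, 0, x $ 2 / 2]))) (at 0)"
    by (simp add: o_def)
  moreover have "frechet_derivative u (at x) (vector [1, 0, x $ 2 / 2]) = X1 u x"
    unfolding vec add scaleR X1_def partial_deriv_def by (simp add: scaleR_conv_of_real)
  ultimately show ?thesis
    unfolding has_vector_derivative_def by (simp add: scaleR)
qed

lemma cmod_square_has_derivative:
  assumes "(p has_vector_derivative p') (at t)"
  shows "((\<lambda>t. (cmod (p t))\<^sup>2) has_real_derivative 2 * (Re (p t) * Re p' + Im (p t) * Im p')) (at t)"
proof -
  have re: "((\<lambda>t. Re (p t)) has_real_derivative Re p') (at t)"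
    and im: "((\<lambda>t. Im (p t)) has_real_derivative Im p') (at t)"
    using bounded_linear.has_vector_derivative[OF bounded_linear_Re assms]
      bounded_linear.has_vector_derivative[OF bounded_linear_Im assms]
    by (simp_all add: has_real_derivative_iff_has_vector_derivative)
  show ?thesis
    using DERIV_add[OF DERIV_power[OF re, of 2] DERIV_power[OF im, of 2]]
    by (simp add: cmod_power2 algebra_simps)
qed

text \<open>The pointwise estimate behind the Hardy inequality. It is applied with \<open>a = 1/g\<^sub>+\<close>,
  \<open>b = 1/g\<^sub>-\<close>, \<open>z = u\<close>, \<open>w = X\<^sub>1 u\<close>, \<open>c = 1 - h\<close> and \<open>k = h x\<^sub>2 x\<^sub>3\<close>; the right-hand side is then
  \<open>X\<^sub>1 (F \<bar>u\<bar>\<^sup>2)\<close> with \<open>F = c/2 (a - b)\<close>. As \<open>a\<close> and \<open>b\<close> have the same sign,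
  \<open>F\<^sup>2 \<le> c\<^sup>2/4 (a\<^sup>2 + b\<^sup>2)\<close>, and the factor \<open>c\<close> in \<open>F\<close> is the one for which \<open>X\<^sub>1 F\<close> is at least twice
  this bound.\<close>

lemma weighted_square_completion:
  fixes a b c k :: real and z w :: complex
  assumes a: "0 \<le> a" and b: "0 \<le> b" and c: "0 \<le> c" and k: "\<bar>k\<bar> \<le> 1 - c"
  shows "c\<^sup>2 / 4 * (a\<^sup>2 + b\<^sup>2) * (cmod z)\<^sup>2 - (cmod w)\<^sup>2
    \<le> c / 2 * ((1 + k) * a\<^sup>2 + (1 - k) * b\<^sup>2) * (cmod z)\<^sup>2
      + c / 2 * (a - b) * (2 * (Re z * Re w + Im z * Im w))"
proof -
  define f where "f = c / 2 * (a - b)"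
  have "0 \<le> (f * Re z + Re w)\<^sup>2 + (f * Im z + Im w)\<^sup>2" by simp
  hence 1: "- f\<^sup>2 * (cmod z)\<^sup>2 - (cmod w)\<^sup>2 \<le> f * (2 * (Re z * Re w + Im z * Im w))"
    unfolding cmod_power2 by (simp add: power2_eq_square algebra_simps)
  have "(a - b)\<^sup>2 \<le> a\<^sup>2 + b\<^sup>2"
    using a b by (simp add: power2_eq_square algebra_simps)
  hence 2: "f\<^sup>2 \<le> c\<^sup>2 / 4 * (a\<^sup>2 + b\<^sup>2)"
    unfolding f_def power_mult_distrib power_divide using c by (intro mult_mono) auto
  have "c * a\<^sup>2 \<le> (1 + k) * a\<^sup>2" "c * b\<^sup>2 \<le> (1 - k) * b\<^sup>2"
    using k by (auto intro!: mult_right_mono)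
  hence "c / 2 * (c * (a\<^sup>2 + b\<^sup>2)) \<le> c / 2 * ((1 + k) * a\<^sup>2 + (1 - k) * b\<^sup>2)"
    using c by (intro mult_left_mono) (auto simp: algebra_simps)
  hence "c\<^sup>2 / 4 * (a\<^sup>2 + b\<^sup>2) + f\<^sup>2 \<le> c / 2 * ((1 + k) * a\<^sup>2 + (1 - k) * b\<^sup>2)"
    using 2 by (simp add: power2_eq_square)
  hence "c\<^sup>2 / 4 * (a\<^sup>2 + b\<^sup>2) * (cmod z)\<^sup>2 + f\<^sup>2 * (cmod z)\<^sup>2
      \<le> c / 2 * ((1 + k) * a\<^sup>2 + (1 - k) * b\<^sup>2) * (cmod z)\<^sup>2"
    unfolding distrib_right[of _ "f\<^sup>2", symmetric] by (intro mult_right_mono) auto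
  thus ?thesis using 1 unfolding f_def[symmetric] by linarith
qed

text \<open>The one-dimensional weight \<open>1/g\<^sub>+ - 1/g\<^sub>-\<close> is smooth on the whole lens, unlike the
  logarithmic derivative of the distance to the boundary, which jumps in the middle of the lens.
  Hence \<open>w = F \<bar>u\<bar>\<^sup>2\<close>, extended by zero, is continuously differentiable along the flow and its
  derivative \<open>D\<close> has integral zero, while \<open>D\<close> dominates the Hardy weight minus \<open>\<bar>X\<^sub>1 u\<bar>\<^sup>2\<close> on the
  lens.\<close>

lemma hardy_lens:
  assumes h: "0 < h" "h \<le> 1" and u: "u \<in> test_functions (lens h)"
  shows "(\<integral>\<^sup>+x\<in>lens h. ennreal ((1 - h)\<^sup>2 / 4 * (1 / (gap h 1 x)\<^sup>2 + 1 / (gap h (- 1) x)\<^sup>2) * (cmod (u x))\<^sup>2) \<partial>lebesgue)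
     \<le> (\<integral>\<^sup>+x\<in>lens h. ennreal ((cmod (X1 u x))\<^sup>2) \<partial>lebesgue)"
proof -
  define K where "K = closure {x. u x \<noteq> 0}"
  have K: "compact K" "K \<subseteq> lens h" and Ck: "\<And>k. C_k k u"
    using u by (auto simp: test_functions_def K_def)
  have diff: "u differentiable (at x)" for x using Ck[of 1] by auto
  have cont_u: "continuous_on S u" for S
    using Ck[of 0] by (auto intro: continuous_on_subset)
  have "continuous_on UNIV (partial_deriv i u)" for i using Ck[of 1] by auto
  hence cont_X1: "continuous_on S (X1 u)" for S
    unfolding X1_def by (auto intro!: continuous_intros intro: continuous_on_subset)
  have u0: "u x = 0" if "x \<notin> K" for x
    using that closure_subset[of "{x. u x \<noteq> 0}"] by (auto simp: K_def)
  have open_K: "open (- K)" using K by (simp add: compact_imp_closed open_Compl)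
  (* Flow lines starting outside the support stay outside for small times. *)
  have off_K: "open {t. flow t x \<in> - K}" for x
    using open_vimage[OF open_K continuous_on_flow[of UNIV "\<lambda>t. t" "\<lambda>_. x"]]
    by (simp add: vimage_def)
  have X1_0: "X1 u x = 0" if "x \<notin> K" for x
  proof -
    have "((\<lambda>t. u (flow t x)) has_vector_derivative 0) (at 0)"
      by (rule has_vector_derivative_transform_within_open[OF has_vector_derivative_const off_K[of x]])
        (use that u0 in auto)
    thus ?thesis using X1_is_derivative_along_flow[OF diff[of x]] vector_derivative_unique_at by blast
  qed
  define P where "P x = 1 / gap h 1 x" for x
  define Q where "Q x = 1 / gap h (- 1) x" for x
  define k where "k x = h * (x $ 2 * x $ 3)" for x :: heisenberg
  define c where "c = 1 - h"
  define w where "w x = c / 2 * (P x - Q x) * (cmod (u x))\<^sup>2" for x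
  define D where "D x = c / 2 * ((1 + k x) * (P x)\<^sup>2 + (1 - k x) * (Q x)\<^sup>2) * (cmod (u x))\<^sup>2
      + c / 2 * (P x - Q x) * (2 * (Re (u x) * Re (X1 u x) + Im (u x) * Im (X1 u x)))" for x
  have pos: "gap h 1 x > 0" "gap h (- 1) x > 0" if "x \<in> lens h" for x
    using that by (auto simp: lens_def)
  have cont_PQ: "continuous_on (lens h) P" "continuous_on (lens h) Q"
    unfolding P_def Q_def using pos by (auto intro!: continuous_intros simp: less_imp_neq[THEN not_sym])
  have cont_w: "continuous_on UNIV w"
  proof -
    have "continuous_on (lens h) w"
      unfolding w_def by (intro continuous_intros cont_PQ cont_u)
    moreover have "continuous_on (- K) w"
      by (subst continuous_on_cong[OF refl, of _ _ "\<lambda>_. 0"]) (auto simp: w_def u0)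
    ultimately have "continuous_on (lens h \<union> - K) w"
      by (intro continuous_on_open_Un open_lens open_K)
    moreover have "lens h \<union> - K = UNIV" using K by auto
    ultimately show ?thesis by simp
  qed
  have "continuous_on K D"
    unfolding D_def k_def
    by (intro continuous_intros continuous_on_subset[OF cont_PQ(1) K(2)] continuous_on_subset[OF cont_PQ(2) K(2)] cont_u cont_X1)
  hence "bounded (D ` K)" using K by (intro compact_imp_bounded compact_continuous_image)
  then obtain M where M: "0 < M" "\<And>x. x \<in> K \<Longrightarrow> norm (D x) \<le> M" unfolding bounded_pos by auto
  have D_bound: "\<bar>D x\<bar> \<le> M" for x
    using M by (cases "x \<in> K") (auto simp: D_def u0)
  obtain R where R: "\<And>x. x \<in> K \<Longrightarrow> norm x \<le> R"
    using compact_imp_bounded[OF K(1)] unfolding bounded_iff by auto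
  have w_supp: "norm x \<le> R" if "w x \<noteq> 0" for x
    using that u0[of x] by (intro R) (auto simp: w_def)
  have w_der: "((\<lambda>t. w (flow t x)) has_real_derivative D x) (at 0)" for x
  proof (cases "x \<in> K")
    case True
    hence x: "x \<in> lens h" using K by auto
    have "((\<lambda>t. flow t x) has_vector_derivative vector [1, 0, x $ 2 / 2]) (at 0)"
      unfolding flow_def by (auto intro!: derivative_eq_intros)
    from gap_has_vector_derivative[OF this]
    have gap: "((\<lambda>t. gap h \<sigma> (flow t x)) has_real_derivative - k x - \<sigma>) (at 0)" for \<sigma>
      by (simp add: has_real_derivative_iff_has_vector_derivative k_def mult_ac)
    have P: "((\<lambda>t. P (flow t x)) has_real_derivative (1 + k x) * (P x)\<^sup>2) (at 0)"
      and Q: "((\<lambda>t. Q (flow t x)) has_real_derivative - (1 - k x) * (Q x)\<^sup>2) (at 0)"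
      unfolding P_def Q_def using pos[OF x]
      by (auto intro!: derivative_eq_intros gap simp: divide_simps power2_eq_square)
    from DERIV_mult[OF DERIV_cmult[OF DERIV_diff[OF P Q], of "c / 2"]
        cmod_square_has_derivative[OF X1_is_derivative_along_flow[OF diff[of x]]]]
    show ?thesis
      unfolding w_def D_def by (rule DERIV_cong) (simp add: algebra_simps)
  next
    case False
    have "((\<lambda>t. w (flow t x)) has_real_derivative 0) (at 0)"
      by (rule has_field_derivative_transform_within_open[OF DERIV_const off_K[of x]])
        (use False u0 in \<open>auto simp: w_def\<close>)
    thus ?thesis using False by (simp add: D_def u0)
  qed
  note int_D = integral_flow_derivative_eq_0[OF cont_w w_supp w_der D_bound]
  define E where "E x = (cmod (X1 u x))\<^sup>2" for x
  have int_E: "integrable lebesgue E"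
    by (rule integrable_continuous_compact_support[OF _ K(1)])
      (auto simp: E_def X1_0 intro!: continuous_intros cont_X1)
  have main: "c\<^sup>2 / 4 * (1 / (gap h 1 x)\<^sup>2 + 1 / (gap h (- 1) x)\<^sup>2) * (cmod (u x))\<^sup>2 \<le> D x + E x"
    if x: "x \<in> lens h" for x
  proof -
    have b: "\<bar>x $ i\<bar> \<le> 1" for i
      using pos[OF x] by (intro gap_nonneg_bounds[OF h]) auto
    have "\<bar>x $ 2\<bar> * \<bar>x $ 3\<bar> \<le> 1 * 1" by (intro mult_mono b) auto
    hence "\<bar>k x\<bar> \<le> 1 - c" using h by (simp add: k_def c_def abs_mult)
    hence "c\<^sup>2 / 4 * ((P x)\<^sup>2 + (Q x)\<^sup>2) * (cmod (u x))\<^sup>2 - E x \<le> D x"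
      unfolding D_def E_def using pos[OF x] h
      by (intro weighted_square_completion) (auto simp: P_def Q_def c_def)
    thus ?thesis unfolding P_def Q_def power_divide power_one by linarith
  qed
  have DE_nonneg: "0 \<le> D x + E x" for x
  proof (cases "x \<in> lens h")
    case True
    have "0 \<le> c\<^sup>2 / 4 * (1 / (gap h 1 x)\<^sup>2 + 1 / (gap h (- 1) x)\<^sup>2) * (cmod (u x))\<^sup>2" by simp
    thus ?thesis using main[OF True] by linarith
  next
    case False
    hence "x \<notin> K" using K by auto
    thus ?thesis by (simp add: D_def E_def u0)
  qed
  have "(\<integral>\<^sup>+x\<in>lens h. ennreal (c\<^sup>2 / 4 * (1 / (gap h 1 x)\<^sup>2 + 1 / (gap h (- 1) x)\<^sup>2) * (cmod (u x))\<^sup>2) \<partial>lebesgue)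
      \<le> (\<integral>\<^sup>+x. ennreal (D x + E x) \<partial>lebesgue)"
    using main by (intro nn_integral_mono) (auto simp: indicator_def intro!: ennreal_leI)
  also have "\<dots> = ennreal (\<integral>x. D x + E x \<partial>lebesgue)"
    using int_D int_E DE_nonneg by (intro nn_integral_eq_integral) auto
  also have "\<dots> = ennreal (\<integral>x. E x \<partial>lebesgue)"
    using int_D int_E by simp
  also have "\<dots> = (\<integral>\<^sup>+x. ennreal (E x) \<partial>lebesgue)"
    by (rule nn_integral_eq_integral[OF int_E, symmetric]) (simp add: E_def)
  also have "\<dots> = (\<integral>\<^sup>+x\<in>lens h. ennreal (E x) \<partial>lebesgue)"
    using K by (intro nn_integral_cong) (auto simp: indicator_def E_def X1_0 subset_eq)
  finally show ?thesis unfolding c_def E_def .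
qed

section \<open>The inequality for the Carnot-Caratheodory distance\<close>

theorem theorem3p3:
  fixes \<epsilon> :: real
  assumes "\<epsilon> > 0"
  shows "\<exists>\<Omega> :: heisenberg set. \<Omega> \<noteq> {} \<and> open \<Omega> \<and> bounded \<Omega> \<and> convex \<Omega> \<and>
    (\<forall>u \<in> test_functions \<Omega>.
       (\<integral>\<^sup>+x\<in>\<Omega>. (ennreal ((cmod (u x))\<^sup>2) / ennreal ((delta_C \<Omega> x)\<^sup>2)) \<partial>lebesgue)
       \<le> ennreal ((2 + \<epsilon>)\<^sup>2) * (\<integral>\<^sup>+x\<in>\<Omega>. ennreal (subgrad_norm_sq u x) \<partial>lebesgue))"
proof -
  define h where "h = min (1 / 2) (\<epsilon> / 20)"
  have h: "0 < h" "h \<le> 1 / 2" "h \<le> \<epsilon> / 20" using assms by (auto simp: h_def)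
  hence h1: "h \<le> 1" by simp
  (* (1 + 4 h) / (1 - h) is at most 1 + 10 h for h \<le> 1/2, hence at most 1 + \<epsilon>/2. *)
  have const: "1 + 4 * h \<le> (2 + \<epsilon>) * ((1 - h) / 2)"
  proof -
    have "10 * h * h \<le> 10 * h * (1 / 2)" using h by (intro mult_left_mono) auto
    hence "1 + 4 * h \<le> (1 + 10 * h) * (1 - h)" by (simp add: algebra_simps)
    also have "\<dots> \<le> (1 + \<epsilon> / 2) * (1 - h)" using h by (intro mult_right_mono) auto
    finally show ?thesis by (simp add: field_simps)
  qed
  have ineq: "(\<integral>\<^sup>+x\<in>lens h. (ennreal ((cmod (u x))\<^sup>2) / ennreal ((delta_C (lens h) x)\<^sup>2)) \<partial>lebesgue)
       \<le> ennreal ((2 + \<epsilon>)\<^sup>2) * (\<integral>\<^sup>+x\<in>lens h. ennreal (subgrad_norm_sq u x) \<partial>lebesgue)"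
    if u: "u \<in> test_functions (lens h)" for u
  proof -
    define W where "W x = (1 - h)\<^sup>2 / 4 * (1 / (gap h 1 x)\<^sup>2 + 1 / (gap h (- 1) x)\<^sup>2)" for x
    have pw: "ennreal ((cmod (u x))\<^sup>2) / ennreal ((delta_C (lens h) x)\<^sup>2)
        \<le> ennreal ((2 + \<epsilon>)\<^sup>2) * ennreal (W x * (cmod (u x))\<^sup>2)" if x: "x \<in> lens h" for x
    proof -
      define m where "m = min (gap h 1 x) (gap h (- 1) x)"
      have m: "0 < m" using x by (simp add: m_def lens_def)
      have \<delta>: "m / (1 + 4 * h) \<le> delta_C (lens h) x"
        unfolding m_def by (rule gap_le_delta_C[OF h(1) h1 x])
      have m\<delta>: "0 < m / (1 + 4 * h)" using m h by simp
      have "1 / (delta_C (lens h) x)\<^sup>2 \<le> 1 / (m / (1 + 4 * h))\<^sup>2"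
        using m\<delta> \<delta> by (intro divide_left_mono power_mono mult_pos_pos zero_less_power) auto
      also have "\<dots> = (1 + 4 * h)\<^sup>2 * (1 / m\<^sup>2)" by (simp add: power_divide)
      also have "\<dots> \<le> ((2 + \<epsilon>) * ((1 - h) / 2))\<^sup>2 * (1 / (gap h 1 x)\<^sup>2 + 1 / (gap h (- 1) x)\<^sup>2)"
      proof (intro mult_mono power_mono const)
        show "1 / m\<^sup>2 \<le> 1 / (gap h 1 x)\<^sup>2 + 1 / (gap h (- 1) x)\<^sup>2"
          unfolding m_def min_def by simp
      qed (use h in auto)
      also have "\<dots> = (2 + \<epsilon>)\<^sup>2 * W x" by (simp add: W_def power_mult_distrib power_divide)
      finally have "(cmod (u x))\<^sup>2 * (1 / (delta_C (lens h) x)\<^sup>2) \<le> (cmod (u x))\<^sup>2 * ((2 + \<epsilon>)\<^sup>2 * W x)"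
        by (intro mult_left_mono) auto
      hence "(cmod (u x))\<^sup>2 / (delta_C (lens h) x)\<^sup>2 \<le> (2 + \<epsilon>)\<^sup>2 * (W x * (cmod (u x))\<^sup>2)"
        by (simp add: mult_ac)
      moreover have "0 < (delta_C (lens h) x)\<^sup>2" using m\<delta> \<delta> by simp
      ultimately show ?thesis
        by (simp add: divide_ennreal ennreal_leI W_def flip: ennreal_mult)
    qed
    have "(\<integral>\<^sup>+x\<in>lens h. (ennreal ((cmod (u x))\<^sup>2) / ennreal ((delta_C (lens h) x)\<^sup>2)) \<partial>lebesgue)
      \<le> (\<integral>\<^sup>+x. ennreal ((2 + \<epsilon>)\<^sup>2) * (ennreal (W x * (cmod (u x))\<^sup>2) * indicator (lens h) x) \<partial>lebesgue)"
      using pw by (intro nn_integral_mono) (auto simp: indicator_def)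
    also have "\<dots> = ennreal ((2 + \<epsilon>)\<^sup>2) * (\<integral>\<^sup>+x\<in>lens h. ennreal (W x * (cmod (u x))\<^sup>2) \<partial>lebesgue)"
    proof (rule nn_integral_cmult)
      have "continuous_on UNIV u"
        using u by (auto simp: test_functions_def dest: spec[of _ 0])
      hence [measurable]: "u \<in> borel_measurable borel"
        by (rule borel_measurable_continuous_onI)
      have [measurable]: "gap h \<sigma> \<in> borel_measurable borel" for \<sigma>
        by (rule borel_measurable_continuous_onI[OF continuous_on_gap])
      have [measurable]: "lens h \<in> sets borel"
        by (rule borel_open[OF open_lens])
      have "(\<lambda>x. ennreal (W x * (cmod (u x))\<^sup>2) * indicator (lens h) x) \<in> borel_measurable lborel"
        unfolding W_def by measurable
      thus "(\<lambda>x. ennreal (W x * (cmod (u x))\<^sup>2) * indicator (lens h) x) \<in> borel_measurable lebesgue"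
        by (rule measurable_completion)
    qed
    also have "\<dots> \<le> ennreal ((2 + \<epsilon>)\<^sup>2) * (\<integral>\<^sup>+x\<in>lens h. ennreal ((cmod (X1 u x))\<^sup>2) \<partial>lebesgue)"
      unfolding W_def by (intro mult_left_mono hardy_lens[OF h(1) h1 u]) auto
    also have "\<dots> \<le> ennreal ((2 + \<epsilon>)\<^sup>2) * (\<integral>\<^sup>+x\<in>lens h. ennreal (subgrad_norm_sq u x) \<partial>lebesgue)"
      by (intro mult_left_mono nn_integral_mono mult_right_mono ennreal_leI) (auto simp: subgrad_norm_sq_def)
    finally show ?thesis .
  qed
  have "0 \<in> lens h" using h by (simp add: lens_def gap_def)
  thus ?thesis
    using open_lens bounded_lens[OF h(1) h1] convex_lens[OF h(1)] ineq by blast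
qed

end
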